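(* Let $X$ be a pointed metric space and let $E$ be a Banach space. The sets $\mathrm{Lip}_0(X,E^* )$ and $\mathrm{Lip}_\pi(X,E^* )$ are equal, where $\pi$ is the Lipschitz projective norm on $X\boxtimes E$. Moreover, $\mathrm{Lip}(f)=\mathrm{Lip}_\pi(f)$ for all $f\in\mathrm{Lip}_0(X,E^* )$.
   Context: $\mathbb{K}$ is the field of real or complex numbers. A pointed metric space $X$ is a metric space with metric $d$ and a designated base point $0$; a normed space over $\mathbb K$ is pointed by its zero vector. For a Banach space $F$, $\mathrm{Lip}_0(X,F)$ is the space of all Lipschitz maps $f\colon X\to F$ with $f(0)=0$, normed by the least Lipschitz constant $\mathrm{Lip}(f)$. $E^*$ is the topological dual of $E$. The Lipschitz tensor product $X\boxtimes E$ is the linear span of all linear functionals $\delta_{(x,y)}\boxtimes e$ on $\mathrm{Lip}_0(X,E^* )$ of the form $(\delta_{(x,y)}\boxtimes e)(f)=\langle f(x)-f(y),e\rangle$, for $x,y\in X$ and $e\in E$. The Lipschitz projective norm on $X\boxtimes E$ is $$\pi(u)=\inf\Big\{\sum_{i=1}^n d(x_i,y_i)\|e_i\|\colon u=\sum_{i=1}^n\delta_{(x_i,y_i)}\boxtimes e_i\Big\}.$$ A norm $\alpha$ on $X\boxtimes E$ is a Lipschitz cross-norm if $\alpha(\delta_{(x,y)}\boxtimes e)=d(x,y)\|e\|$ for all $x,y\in X$, $e\in E$ ($\pi$ is one). For a Lipschitz cross-norm $\alpha$ on $X\boxtimes E$, a base-point preserving map $f\colon X\to E^*$ is an $\alpha$-Lipschitz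 operator if there is $C\ge 0$ with $\left|\sum_{i=1}^n\langle f(x_i)-f(y_i),e_i\rangle\right|\le C\,\alpha\left(\sum_{i=1}^n\delta_{(x_i,y_i)}\boxtimes e_i\right)$ for all $\sum_{i=1}^n\delta_{(x_i,y_i)}\boxtimes e_i\in X\boxtimes E$; the infimum of such $C$ is $\mathrm{Lip}_\alpha(f)$, and $\mathrm{Lip}_\alpha(X,E^* )$ is the set of all $\alpha$-Lipschitz operators from $X$ to $E^*$. *)

theory Defs
  imports "HOL-Analysis.Analysis" "HOL-Library.Function_Algebras"
begin

text \<open>The normed fields isometrically isomorphic to \<open>\<real>\<close> or to \<open>\<complex>\<close>.\<close>

class real_or_complex_field = real_normed_field +
  assumes real_or_complex:
    "(\<exists>\<phi> :: 'a \<Rightarrow> real. bij \<phi> \<and> (\<forall>a b. \<phi> (a + b) = \<phi> a + \<phi> b)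
        \<and> (\<forall>a b. \<phi> (a * b) = \<phi> a * \<phi> b) \<and> (\<forall>a. norm (\<phi> a) = norm a))
     \<or> (\<exists>\<phi> :: 'a \<Rightarrow> complex. bij \<phi> \<and> (\<forall>a b. \<phi> (a + b) = \<phi> a + \<phi> b)
        \<and> (\<forall>a b. \<phi> (a * b) = \<phi> a * \<phi> b) \<and> (\<forall>a. norm (\<phi> a) = norm a))"

instance real :: real_or_complex_field
  by standard (auto intro!: exI[of _ "\<lambda>x. x"] bij_id[unfolded id_def])

instance complex :: real_or_complex_field
  by standard (auto intro!: disjI2 exI[of _ "\<lambda>x. x"] bij_id[unfolded id_def])

text \<open>The class \<open>banach\<close> only knows real scalars, so the \<open>\<bbbK>\<close>-structure of a Banach space
  is an explicit scalar multiplication, compatible with the norm and with \<open>scaleR\<close>.\<close>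

locale banach_space_over = vector_space smul
  for smul :: "'k::real_or_complex_field \<Rightarrow> 'e::banach \<Rightarrow> 'e" +
  assumes norm_smul: "norm (smul a v) = norm a * norm v"
    and smul_of_real: "smul (of_real r) v = r *\<^sub>R v"

lemma banach_space_over_scaleR: "banach_space_over (scaleR :: real \<Rightarrow> 'e::banach \<Rightarrow> 'e)"
  by (intro banach_space_over.intro banach_space_over_axioms.intro) (unfold_locales, simp_all add: algebra_simps)

text \<open>\<open>E\<^sup>*\<close> consists of the \<open>\<bbbK>\<close>-linear maps among the bounded real-linear ones; its norm is
  the operator norm of \<open>\<Rightarrow>\<^sub>L\<close>.\<close>

definition topological_dual ::
  "('k::real_or_complex_field \<Rightarrow> 'e::banach \<Rightarrow> 'e) \<Rightarrow> ('e \<Rightarrow>\<^sub>L 'k) set" where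
  "topological_dual smul = {\<phi>. \<forall>a v. blinfun_apply \<phi> (smul a v) = a * blinfun_apply \<phi> v}"

text \<open>\<open>Lip0 b F\<close> is \<open>Lip\<^sub>0(X, F)\<close> for the metric space \<open>X\<close> with base point \<open>b\<close>.\<close>

definition Lip0 :: "'x::metric_space \<Rightarrow> 'f::real_normed_vector set \<Rightarrow> ('x \<Rightarrow> 'f) set" where
  "Lip0 b F = {f. (\<forall>x. f x \<in> F) \<and> f b = 0 \<and> (\<exists>C. C-lipschitz_on UNIV f)}"

definition Lip :: "('x::metric_space \<Rightarrow> 'f::real_normed_vector) \<Rightarrow> real" where
  "Lip f = Inf {C. C-lipschitz_on UNIV f}"

text \<open>Functionals on \<open>Lip\<^sub>0(X, E\<^sup>*)\<close> are functions extended by \<open>0\<close> outside this space, so that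
  equality of functions is equality on \<open>Lip\<^sub>0(X, E\<^sup>*)\<close>, and sums are pointwise.\<close>

type_synonym ('x, 'e, 'k) lip_functional = "('x \<Rightarrow> ('e \<Rightarrow>\<^sub>L 'k)) \<Rightarrow> 'k"

definition delta_tensor ::
  "'x::metric_space \<Rightarrow> ('k::real_or_complex_field \<Rightarrow> 'e::banach \<Rightarrow> 'e) \<Rightarrow>
     'x \<Rightarrow> 'x \<Rightarrow> 'e \<Rightarrow> ('x, 'e, 'k) lip_functional" where
  "delta_tensor b smul x y e =
     (\<lambda>f. if f \<in> Lip0 b (topological_dual smul) then blinfun_apply (f x - f y) e else 0)"

definition lipschitz_tensor_product ::
  "'x::metric_space \<Rightarrow> ('k::real_or_complex_field \<Rightarrow> 'e::banach \<Rightarrow> 'e) \<Rightarrow>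
     ('x, 'e, 'k) lip_functional set" where
  "lipschitz_tensor_product b smul =
     module.span (\<lambda>a u f. a * u f)
       {delta_tensor b smul x y e | x y e. True}"

definition lipschitz_projective_norm ::
  "'x::metric_space \<Rightarrow> ('k::real_or_complex_field \<Rightarrow> 'e::banach \<Rightarrow> 'e) \<Rightarrow>
     ('x, 'e, 'k) lip_functional \<Rightarrow> real" where
  "lipschitz_projective_norm b smul u =
     Inf {(\<Sum>i<n. dist (x i) (y i) * norm (e i)) | (n::nat) x y e.
            u = (\<Sum>i<n. delta_tensor b smul (x i) (y i) (e i))}"

text \<open>The maps \<open>f\<close> below need not be in \<open>Lip\<^sub>0(X, E\<^sup>*)\<close>, so the bound is required for
  every representation of \<open>u\<close>. Only the values of \<open>\<alpha>\<close> on the tensor product matter.\<close>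

definition alpha_lipschitz_bound ::
  "'x::metric_space \<Rightarrow> ('k::real_or_complex_field \<Rightarrow> 'e::banach \<Rightarrow> 'e) \<Rightarrow>
     (('x, 'e, 'k) lip_functional \<Rightarrow> real) \<Rightarrow> ('x \<Rightarrow> ('e \<Rightarrow>\<^sub>L 'k)) \<Rightarrow> real \<Rightarrow> bool" where
  "alpha_lipschitz_bound b smul \<alpha> f C \<longleftrightarrow> 0 \<le> C \<and>
     (\<forall>u \<in> lipschitz_tensor_product b smul. \<forall>(n::nat) x y e.
        u = (\<Sum>i<n. delta_tensor b smul (x i) (y i) (e i)) \<longrightarrow>
        norm (\<Sum>i<n. blinfun_apply (f (x i) - f (y i)) (e i)) \<le> C * \<alpha> u)"

definition Lip_alpha_space ::
  "'x::metric_space \<Rightarrow> ('k::real_or_complex_field \<Rightarrow> 'e::banach \<Rightarrow> 'e) \<Rightarrow>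
     (('x, 'e, 'k) lip_functional \<Rightarrow> real) \<Rightarrow> ('x \<Rightarrow> ('e \<Rightarrow>\<^sub>L 'k)) set" where
  "Lip_alpha_space b smul \<alpha> =
     {f. (\<forall>x. f x \<in> topological_dual smul) \<and> f b = 0 \<and> (\<exists>C. alpha_lipschitz_bound b smul \<alpha> f C)}"

definition Lip_alpha ::
  "'x::metric_space \<Rightarrow> ('k::real_or_complex_field \<Rightarrow> 'e::banach \<Rightarrow> 'e) \<Rightarrow>
     (('x, 'e, 'k) lip_functional \<Rightarrow> real) \<Rightarrow> ('x \<Rightarrow> ('e \<Rightarrow>\<^sub>L 'k)) \<Rightarrow> real" where
  "Lip_alpha b smul \<alpha> f = Inf {C. alpha_lipschitz_bound b smul \<alpha> f C}"

end

theory Submission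
  imports Defs
begin

text \<open>
  Both assertions follow from one equivalence: for a base-point preserving map \<open>f\<close> into
  \<open>E\<^sup>*\<close> and a real number \<open>C\<close>, the constant \<open>C\<close> is a Lipschitz constant of \<open>f\<close> if and only
  if it is a \<open>\<pi>\<close>-Lipschitz constant of \<open>f\<close>. The two spaces ask for the existence of such a
  \<open>C\<close>, and \<open>Lip f\<close> and \<open>Lip\<^sub>\<pi> f\<close> are the infima of the same set.

  If \<open>f\<close> is \<open>C\<close>-Lipschitz, then \<open>f\<close> lies in the domain of the functional \<open>u\<close>, so the sum
  to be estimated is the value \<open>u f\<close> and is therefore the same for every representation of \<open>u\<close>. The
  triangle inequality bounds it by \<open>C \<Sum> d(x\<^sub>i, y\<^sub>i) \<parallel>e\<^sub>i\<parallel>\<close> for each representation, and the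
  infimum over the representations gives \<open>C \<pi>(u)\<close>
  (\<open>norm_eval_le_lipschitz_projective_norm\<close>). Conversely, an elementary tensor represents
  itself, so \<open>\<pi>(\<delta>\<^bsub>(x,y)\<^esub> \<boxtimes> e) \<le> d(x, y) \<parallel>e\<parallel>\<close>
  (\<open>lipschitz_projective_norm_delta_tensor_le\<close>); testing a \<open>\<pi>\<close>-Lipschitz map on elementary
  tensors bounds the operator norm of \<open>f x - f y\<close> by \<open>C d(x, y)\<close>.
\<close>

lemma sum_delta_tensor_apply:
  fixes b :: "'x::metric_space"
    and smul :: "'k::real_or_complex_field \<Rightarrow> 'e::banach \<Rightarrow> 'e"
    and n :: nat
  assumes "f \<in> Lip0 b (topological_dual smul)"
  shows "(\<Sum>i<n. delta_tensor b smul (x i) (y i) (e i)) f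
           = (\<Sum>i<n. blinfun_apply (f (x i) - f (y i)) (e i))"
  using assms by (induction n) (auto simp: delta_tensor_def)

lemma delta_tensor_in_lipschitz_tensor_product:
  fixes b :: "'x::metric_space"
    and smul :: "'k::real_or_complex_field \<Rightarrow> 'e::banach \<Rightarrow> 'e"
  shows "delta_tensor b smul x y e \<in> lipschitz_tensor_product b smul"
proof -
  have "module (\<lambda>(a::'k) (u::('x, 'e, 'k) lip_functional) f. a * u f)"
    by standard (auto simp: fun_eq_iff algebra_simps)
  then show ?thesis
    unfolding lipschitz_tensor_product_def by (rule module.span_base) blast
qed

lemma norm_sum_blinfun_diff_le:
  fixes f :: "'x::metric_space \<Rightarrow> ('e::real_normed_vector \<Rightarrow>\<^sub>L 'k::real_normed_vector)"
  assumes "C-lipschitz_on UNIV f"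
  shows "norm (\<Sum>i\<in>I. blinfun_apply (f (x i) - f (y i)) (e i))
           \<le> C * (\<Sum>i\<in>I. dist (x i) (y i) * norm (e i))"
proof -
  have "norm (blinfun_apply (f (x i) - f (y i)) (e i)) \<le> C * (dist (x i) (y i) * norm (e i))" for i
  proof -
    have "norm (blinfun_apply (f (x i) - f (y i)) (e i)) \<le> norm (f (x i) - f (y i)) * norm (e i)"
      by (rule norm_blinfun)
    also have "\<dots> \<le> (C * dist (x i) (y i)) * norm (e i)"
      using lipschitz_onD[OF assms, of "x i" "y i"]
      by (intro mult_right_mono) (auto simp: dist_norm)
    finally show ?thesis by (simp add: mult.assoc)
  qed
  then show ?thesis
    by (auto simp: sum_distrib_left intro: sum_norm_le)
qed

text \<open>The left-hand side does not depend on the representation of \<open>u\<close>, so the infimum over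
  all representations may be taken on the right. Some representation has to exist because the
  infimum of the empty set carries no information.\<close>

lemma norm_eval_le_lipschitz_projective_norm:
  fixes b :: "'x::metric_space"
    and smul :: "'k::real_or_complex_field \<Rightarrow> 'e::banach \<Rightarrow> 'e"
    and n :: nat
  assumes f: "f \<in> Lip0 b (topological_dual smul)" and C: "C-lipschitz_on UNIV f"
    and u: "u = (\<Sum>i<n. delta_tensor b smul (x i) (y i) (e i))"
  shows "norm (u f) \<le> C * lipschitz_projective_norm b smul u"
proof -
  let ?S = "{(\<Sum>i<m. dist (x i) (y i) * norm (e i)) | (m::nat) x y e.
               u = (\<Sum>i<m. delta_tensor b smul (x i) (y i) (e i))}"
  have bound: "norm (u f) \<le> C * s" if "s \<in> ?S" for s
    using that norm_sum_blinfun_diff_le[OF C] by (auto simp: sum_delta_tensor_apply[OF f])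
  have ne: "?S \<noteq> {}"
    using u by blast
  show ?thesis
  proof (cases "C = 0")
    case True
    then show ?thesis using bound ne by fastforce
  next
    case False
    then have "C > 0" using lipschitz_on_nonneg[OF C] by simp
    then have "norm (u f) / C \<le> Inf ?S"
      using bound by (intro cInf_greatest[OF ne]) (simp add: pos_divide_le_eq mult.commute)
    with \<open>C > 0\<close> show ?thesis
      unfolding lipschitz_projective_norm_def by (simp add: pos_divide_le_eq mult.commute)
  qed
qed

lemma lipschitz_projective_norm_delta_tensor_le:
  fixes b :: "'x::metric_space"
    and smul :: "'k::real_or_complex_field \<Rightarrow> 'e::banach \<Rightarrow> 'e"
  shows "lipschitz_projective_norm b smul (delta_tensor b smul x y e) \<le> dist x y * norm e"
  unfolding lipschitz_projective_norm_def
proof (rule cInf_lower, rule CollectI)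
  show "\<exists>(n::nat) x' y' e'. dist x y * norm e = (\<Sum>i<n. dist (x' i) (y' i) * norm (e' i))
          \<and> delta_tensor b smul x y e = (\<Sum>i<n. delta_tensor b smul (x' i) (y' i) (e' i))"
    by (intro exI[of _ "1::nat"] exI[of _ "\<lambda>_. x"] exI[of _ "\<lambda>_. y"] exI[of _ "\<lambda>_. e"]) simp
qed (auto intro!: bdd_belowI[of _ 0] sum_nonneg)

text \<open>An \<open>\<alpha>\<close>-Lipschitz bound concerns every representation of a tensor even for maps that
  are not known to be Lipschitz, so it applies directly to the one-term representation of
  \<open>\<delta>\<^bsub>(x,y)\<^esub> \<boxtimes> e\<close>.\<close>

lemma lipschitz_on_of_projective_bound:
  fixes b :: "'x::metric_space"
    and smul :: "'k::real_or_complex_field \<Rightarrow> 'e::banach \<Rightarrow> 'e"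
  assumes "alpha_lipschitz_bound b smul (lipschitz_projective_norm b smul) f C"
  shows "C-lipschitz_on UNIV f"
proof (rule lipschitz_onI)
  show C: "0 \<le> C"
    using assms by (simp add: alpha_lipschitz_bound_def)
  fix x y
  have "norm (blinfun_apply (f x - f y) e) \<le> C * dist x y * norm e" for e
  proof -
    let ?u = "delta_tensor b smul x y e"
    have "?u = (\<Sum>i<1::nat. ?u) \<longrightarrow>
        norm (\<Sum>i<1::nat. blinfun_apply (f x - f y) e) \<le> C * lipschitz_projective_norm b smul ?u"
      using assms[unfolded alpha_lipschitz_bound_def, THEN conjunct2, THEN bspec,
          OF delta_tensor_in_lipschitz_tensor_product,
          THEN spec[of _ 1], THEN spec[of _ "\<lambda>_. x"], THEN spec[of _ "\<lambda>_. y"],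
          THEN spec[of _ "\<lambda>_. e"]] .
    then have "norm (blinfun_apply (f x - f y) e) \<le> C * lipschitz_projective_norm b smul ?u"
      by simp
    also have "\<dots> \<le> C * (dist x y * norm e)"
      by (intro mult_left_mono lipschitz_projective_norm_delta_tensor_le C)
    finally show ?thesis by (simp add: mult.assoc)
  qed
  with C show "dist (f x) (f y) \<le> C * dist x y"
    by (auto simp: dist_norm intro!: norm_blinfun_bound)
qed

lemma projective_bound_iff_lipschitz_on:
  fixes b :: "'x::metric_space"
    and smul :: "'k::real_or_complex_field \<Rightarrow> 'e::banach \<Rightarrow> 'e"
  assumes dual: "\<And>x. f x \<in> topological_dual smul" and base: "f b = 0"
  shows "alpha_lipschitz_bound b smul (lipschitz_projective_norm b smul) f C
           \<longleftrightarrow> C-lipschitz_on UNIV f"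
proof
  assume C: "C-lipschitz_on UNIV f"
  with dual base have f: "f \<in> Lip0 b (topological_dual smul)"
    by (auto simp: Lip0_def)
  show "alpha_lipschitz_bound b smul (lipschitz_projective_norm b smul) f C"
    unfolding alpha_lipschitz_bound_def
    using lipschitz_on_nonneg[OF C] norm_eval_le_lipschitz_projective_norm[OF f C refl]
    by (auto simp: sum_delta_tensor_apply[OF f])
qed (rule lipschitz_on_of_projective_bound)

theorem lemma2p5:
  fixes b :: "'x::metric_space"
    and smul :: "'k::real_or_complex_field \<Rightarrow> 'e::banach \<Rightarrow> 'e"
  assumes "banach_space_over smul"
  shows "Lip0 b (topological_dual smul) =
           Lip_alpha_space b smul (lipschitz_projective_norm b smul)
       \<and> (\<forall>f \<in> Lip0 b (topological_dual smul).
            Lip f = Lip_alpha b smul (lipschitz_projective_norm b smul) f)"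
proof (intro conjI ballI)
  show "Lip0 b (topological_dual smul) =
          Lip_alpha_space b smul (lipschitz_projective_norm b smul)"
    unfolding Lip0_def Lip_alpha_space_def
    using projective_bound_iff_lipschitz_on[of _ smul b] by blast
next
  fix f assume "f \<in> Lip0 b (topological_dual smul)"
  then have "alpha_lipschitz_bound b smul (lipschitz_projective_norm b smul) f C
               \<longleftrightarrow> C-lipschitz_on UNIV f" for C
    by (intro projective_bound_iff_lipschitz_on) (auto simp: Lip0_def)
  then show "Lip f = Lip_alpha b smul (lipschitz_projective_norm b smul) f"
    by (simp add: Lip_def Lip_alpha_def)
qed

end
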